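(* Every $2$--cohesive set which is $\Pi^0_2$ has Turing degree $\mathbf{0}''$.
   Context: A $2$--coloring of $[\omega]^2$ (the $2$--element subsets of $\omega$) is a function $\mathcal{C}:[\omega]^2\to\{0,1\}$; it is computably enumerable if one of its color classes is c.e. under a standard coding. $A$ is almost homogeneous for $\mathcal{C}$ if there is a finite $F$ such that $\mathcal{C}$ is constant on $[A\setminus F]^2$. An infinite set $A$ is $2$--cohesive if it is almost homogeneous for every computably enumerable $2$--coloring of $[\omega]^2$. $\mathbf{0}''$ is the degree of the double jump of $\emptyset$. *)

theory Defs
  imports Complex_Main "HOL-Library.Ramsey" "HOL-Library.Nat_Bijection"
begin

text \<open>
  Computability relative to a set \<open>B\<close>. The libraries contain no recursion theory, so the
  functions that are partial recursive in \<open>B\<close> are generated from the usual initial functions and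
  the characteristic function of \<open>B\<close> by composition, primitive recursion and minimisation.
  All functions are unary; several arguments are passed through the Cantor pairing
  \<^const>\<open>prod_encode\<close>.
\<close>

datatype prog =
    Zero
  | Succ
  | Left
  | Right
  | Query
  | Pairing prog prog
  | Comp prog prog
  | Prec prog prog
  | Mu prog

text \<open>\<open>computes B p x y\<close>: program \<open>p\<close>, relative to \<open>B\<close>, halts on input \<open>x\<close> with output \<open>y\<close>.\<close>

inductive computes :: "nat set \<Rightarrow> prog \<Rightarrow> nat \<Rightarrow> nat \<Rightarrow> bool" for B :: "nat set" where
  zero: "computes B Zero x 0"
| succ: "computes B Succ x (Suc x)"
| left: "computes B Left (prod_encode (x, y)) x"
| right: "computes B Right (prod_encode (x, y)) y"
| query: "computes B Query x (if x \<in> B then 1 else 0)"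
| pair: "computes B p x y \<Longrightarrow> computes B q x z \<Longrightarrow> computes B (Pairing p q) x (prod_encode (y, z))"
| comp: "computes B q x y \<Longrightarrow> computes B p y z \<Longrightarrow> computes B (Comp p q) x z"
| prec_0: "computes B p x y \<Longrightarrow> computes B (Prec p q) (prod_encode (x, 0)) y"
| prec_Suc: "computes B (Prec p q) (prod_encode (x, n)) y \<Longrightarrow>
    computes B q (prod_encode (x, prod_encode (n, y))) z \<Longrightarrow>
    computes B (Prec p q) (prod_encode (x, Suc n)) z"
| mu: "computes B p (prod_encode (x, n)) 0 \<Longrightarrow>
    (\<And>m. m < n \<Longrightarrow> \<exists>y. computes B p (prod_encode (x, m)) (Suc y)) \<Longrightarrow>
    computes B (Mu p) x n"

definition halts :: "nat set \<Rightarrow> prog \<Rightarrow> nat \<Rightarrow> bool" where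
  "halts B p x \<longleftrightarrow> (\<exists>y. computes B p x y)"

lemma computes_functional: "computes B p x y \<Longrightarrow> computes B p x z \<Longrightarrow> y = z"
proof (induction arbitrary: z rule: computes.induct)
  case (pair p x y q z)
  from pair.prems show ?case
    by cases (metis pair.IH)
next
  case (comp q x y p z)
  from comp.prems show ?case
    by cases (metis comp.IH)
next
  case (prec_0 p x y q)
  from prec_0.prems have "computes B p x z"
    by cases (auto simp: prod_encode_eq)
  then show ?case by (rule prec_0.IH)
next
  case (prec_Suc p q x n y z')
  from prec_Suc.prems obtain y' where
    "computes B (Prec p q) (prod_encode (x, n)) y'"
    "computes B q (prod_encode (x, prod_encode (n, y'))) z"
    by cases (auto simp: prod_encode_eq)
  with prec_Suc.IH show ?case by metis
next
  case (mu p x n)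
  from mu.prems obtain
    z: "computes B p (prod_encode (x, z)) 0"
      "\<And>m. m < z \<Longrightarrow> \<exists>y. computes B p (prod_encode (x, m)) (Suc y)"
    by cases auto
  have "\<not> z < n" using mu.IH(2) z(1) by fastforce
  moreover have "\<not> n < z" using mu.IH(1) z(2) by fastforce
  ultimately show ?case by simp
qed (erule computes.cases; simp add: prod_encode_eq)+

text \<open>Goedel numbers of programs, with \<open>Query\<close> included so that they serve every \<open>B\<close>.\<close>

fun prog_code :: "prog \<Rightarrow> nat" where
  "prog_code Zero = prod_encode (0, 0)"
| "prog_code Succ = prod_encode (1, 0)"
| "prog_code Left = prod_encode (2, 0)"
| "prog_code Right = prod_encode (3, 0)"
| "prog_code Query = prod_encode (4, 0)"
| "prog_code (Pairing p q) = prod_encode (5, prod_encode (prog_code p, prog_code q))"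
| "prog_code (Comp p q) = prod_encode (6, prod_encode (prog_code p, prog_code q))"
| "prog_code (Prec p q) = prod_encode (7, prod_encode (prog_code p, prog_code q))"
| "prog_code (Mu p) = prod_encode (8, prog_code p)"

lemma prog_code_inject: "prog_code p = prog_code q \<longleftrightarrow> p = q"
  by (induction p arbitrary: q; case_tac q; simp add: prod_encode_eq)

text \<open>A number that is not the code of a program indexes the nowhere defined function.\<close>

definition jump :: "nat set \<Rightarrow> nat set" where
  "jump B = {e. \<exists>p. e = prog_code p \<and> halts B p e}"

definition turing_reducible :: "nat set \<Rightarrow> nat set \<Rightarrow> bool" where
  "turing_reducible A B \<longleftrightarrow> (\<exists>p. \<forall>x. computes B p x (if x \<in> A then 1 else 0))"

definition turing_equivalent :: "nat set \<Rightarrow> nat set \<Rightarrow> bool" where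
  "turing_equivalent A B \<longleftrightarrow> turing_reducible A B \<and> turing_reducible B A"

definition turing_degree :: "nat set \<Rightarrow> nat set set" where
  "turing_degree A = {B. turing_equivalent A B}"

definition computable_set :: "nat set \<Rightarrow> bool" where
  "computable_set A \<longleftrightarrow> turing_reducible A {}"

definition ce_set :: "nat set \<Rightarrow> bool" where
  "ce_set A \<longleftrightarrow> (\<exists>p. A = {x. halts {} p x})"

definition Pi2_set :: "nat set \<Rightarrow> bool" where
  "Pi2_set A \<longleftrightarrow> (\<exists>R. computable_set R \<and>
     A = {x. \<forall>y. \<exists>z. prod_encode (x, prod_encode (y, z)) \<in> R})"

text \<open>
  A colouring is a function on \<^typ>\<open>nat set\<close> of which only the values on \<open>[UNIV]\<^bsup>2\<^esup>\<close> matter;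
  the pair \<open>{x, y}\<close> with \<open>x < y\<close> is coded by \<open>prod_encode (x, y)\<close>.
\<close>

definition two_coloring :: "(nat set \<Rightarrow> nat) \<Rightarrow> bool" where
  "two_coloring c \<longleftrightarrow> c \<in> [UNIV]\<^bsup>2\<^esup> \<rightarrow> {0, 1}"

definition pair_code :: "nat set \<Rightarrow> nat" where
  "pair_code s = prod_encode (Min s, Max s)"

definition ce_two_coloring :: "(nat set \<Rightarrow> nat) \<Rightarrow> bool" where
  "ce_two_coloring c \<longleftrightarrow> two_coloring c \<and>
     (\<exists>i\<in>{0, 1}. ce_set (pair_code ` {s \<in> [UNIV]\<^bsup>2\<^esup>. c s = i}))"

definition almost_homogeneous :: "nat set \<Rightarrow> (nat set \<Rightarrow> nat) \<Rightarrow> bool" where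
  "almost_homogeneous A c \<longleftrightarrow> (\<exists>F. finite F \<and> (\<exists>i. \<forall>s \<in> [A - F]\<^bsup>2\<^esup>. c s = i))"

definition two_cohesive :: "nat set \<Rightarrow> bool" where
  "two_cohesive A \<longleftrightarrow> infinite A \<and> (\<forall>c. ce_two_coloring c \<longrightarrow> almost_homogeneous A c)"

end

theory Submission
  imports Defs
begin

text \<open>
  That \<open>A \<le>\<^sub>T \<emptyset>''\<close> is immediate from the form of \<open>A\<close>. For the converse write
  \<open>e \<in> \<emptyset>'' \<longleftrightarrow> (\<exists>u. \<forall>v. \<not> Q e u v)\<close> and \<open>x \<in> A \<longleftrightarrow> (\<forall>a. \<exists>z. R x a z)\<close> with computable \<open>Q\<close>, \<open>R\<close>.
  The set \<open>A\<close> decides every c.e. set: colour \<open>{x, y}\<close> by whether some \<open>e < x\<close> is enumerated only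
  after stage \<open>y\<close>. If \<open>e \<in> \<emptyset>''\<close>, let \<open>u0\<close> be the least witness; the superset
  \<open>{x. \<forall>a\<le>u0. \<exists>z. R x a z}\<close> of \<open>A\<close> and each of its initial parts can be approximated in the
  limit \<open>y \<rightarrow> \<infinity>\<close>. Following Jockusch, colour \<open>{x, y}\<close> so that for every \<open>j = \<langle>e, N\<rangle> < y\<close> the first
  \<open>2 j + 2\<close> elements \<open>\<ge> j\<close> of that superset, as approximated at stage \<open>y\<close>, are not all paired with
  \<open>y\<close> in one colour. Since \<open>A\<close> is almost homogeneous, these elements do not all lie in \<open>A\<close>, which
  yields the completeness argument for effectively simple sets: find \<open>b\<close> with
  \<open>2 j + 2\<close> elements of \<open>A\<close> in \<open>[j, b)\<close> and \<open>u\<close> such that no element of \<open>[j, b) - A\<close> passes level \<open>u\<close>;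
  if \<open>e\<close> has no witness up to \<open>u\<close>, then \<open>e \<notin> \<emptyset>''\<close>.
\<close>

subsection \<open>Computable functions and predicates\<close>

definition proj1 :: "nat \<Rightarrow> nat" where "proj1 x = fst (prod_decode x)"
definition proj2 :: "nat \<Rightarrow> nat" where "proj2 x = snd (prod_decode x)"

lemma proj_prod_encode [simp]:
  "proj1 (prod_encode (x, y)) = x" "proj2 (prod_encode (x, y)) = y"
  by (simp_all add: proj1_def proj2_def)

lemma prod_encode_proj [simp]: "prod_encode (proj1 x, proj2 x) = x"
  by (simp add: proj1_def proj2_def)

definition rec_fun :: "nat set \<Rightarrow> (nat \<Rightarrow> nat) \<Rightarrow> bool" where
  "rec_fun B f \<longleftrightarrow> (\<exists>p. \<forall>x. computes B p x (f x))"

definition dec :: "nat set \<Rightarrow> (nat \<Rightarrow> bool) \<Rightarrow> bool" where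
  "dec B P \<longleftrightarrow> rec_fun B (\<lambda>x. if P x then 1 else 0)"

lemma turing_reducible_iff_dec: "turing_reducible A B \<longleftrightarrow> dec B (\<lambda>x. x \<in> A)"
  by (simp add: turing_reducible_def dec_def rec_fun_def)

named_theorems recs

lemma rec_fun_comp:
  assumes "rec_fun B f" "rec_fun B g"
  shows "rec_fun B (\<lambda>x. f (g x))"
  using assms unfolding rec_fun_def by (meson computes.comp)

lemma dec_comp: "dec B P \<Longrightarrow> rec_fun B g \<Longrightarrow> dec B (\<lambda>x. P (g x))"
  unfolding dec_def by (rule rec_fun_comp)

lemma rec_fun_pair [recs]:
  "rec_fun B f \<Longrightarrow> rec_fun B g \<Longrightarrow> rec_fun B (\<lambda>x. prod_encode (f x, g x))"
  unfolding rec_fun_def by (meson computes.pair)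

lemma rec_fun_Left: "rec_fun B proj1"
  unfolding rec_fun_def by (metis computes.left prod_encode_proj)

lemma rec_fun_Right: "rec_fun B proj2"
  unfolding rec_fun_def by (metis computes.right prod_encode_proj)

lemmas rec_fun_proj1 [recs] = rec_fun_comp [OF rec_fun_Left]
lemmas rec_fun_proj2 [recs] = rec_fun_comp [OF rec_fun_Right]

lemma rec_fun_id [recs]: "rec_fun B (\<lambda>x. x)"
  using rec_fun_pair [OF rec_fun_Left rec_fun_Right, of B] by simp

lemma rec_fun_Suc [recs]: "rec_fun B f \<Longrightarrow> rec_fun B (\<lambda>x. Suc (f x))"
  unfolding rec_fun_def by (meson computes.comp computes.succ)

lemma rec_fun_const [recs]: "rec_fun B (\<lambda>x. n)"
proof (induction n)
  case 0
  show ?case unfolding rec_fun_def by (meson computes.zero)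
next
  case (Suc n)
  then show ?case by (rule rec_fun_Suc)
qed

lemma rec_fun_rec_nat [recs]:
  assumes "rec_fun B a"
    and "rec_fun B (\<lambda>w. h (proj1 w) (proj1 (proj2 w)) (proj2 (proj2 w)))"
    and "rec_fun B k"
  shows "rec_fun B (\<lambda>x. rec_nat (a x) (h x) (k x))"
proof -
  obtain p where p: "\<And>x. computes B p x (a x)" using assms(1) unfolding rec_fun_def by blast
  obtain q where q: "\<And>x. computes B q x (h (proj1 x) (proj1 (proj2 x)) (proj2 (proj2 x)))"
    using assms(2) unfolding rec_fun_def by blast
  have "computes B (Prec p q) (prod_encode (x, n)) (rec_nat (a x) (h x) n)" for x n
  proof (induction n)
    case 0
    show ?case using computes.prec_0 [OF p] by simp
  next
    case (Suc n)
    show ?case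
      using computes.prec_Suc [OF Suc q] by simp
  qed
  then have "rec_fun B (\<lambda>w. rec_nat (a (proj1 w)) (h (proj1 w)) (proj2 w))"
    unfolding rec_fun_def by (metis prod_encode_proj)
  from rec_fun_comp [OF this rec_fun_pair [OF rec_fun_id assms(3)]] show ?thesis by simp
qed

lemma rec_fun_plus [recs]:
  assumes "rec_fun B f" "rec_fun B g" shows "rec_fun B (\<lambda>x. f x + g x)"
proof -
  have "rec_nat m (\<lambda>_ r. Suc r) n = m + n" for m n :: nat by (induction n) auto
  moreover have "rec_fun B (\<lambda>x. rec_nat (f x) (\<lambda>_ r. Suc r) (g x))" by (intro recs assms)
  ultimately show ?thesis by simp
qed

lemma rec_fun_times [recs]:
  assumes "rec_fun B f" "rec_fun B g" shows "rec_fun B (\<lambda>x. f x * g x)"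
proof -
  have "rec_nat 0 (\<lambda>_ r. r + m) n = m * n" for m n :: nat by (induction n) auto
  moreover have "rec_fun B (\<lambda>x. rec_nat 0 (\<lambda>_ r. r + f x) (g x))"
    by (intro recs assms rec_fun_comp [OF assms(1)])
  ultimately show ?thesis by simp
qed

lemma rec_fun_power [recs]:
  assumes "rec_fun B f" "rec_fun B g" shows "rec_fun B (\<lambda>x. f x ^ g x)"
proof -
  have "rec_nat 1 (\<lambda>_ r. r * m) n = m ^ n" for m n :: nat by (induction n) auto
  moreover have "rec_fun B (\<lambda>x. rec_nat 1 (\<lambda>_ r. r * f x) (g x))"
    by (intro recs assms rec_fun_comp [OF assms(1)])
  ultimately show ?thesis by simp
qed

lemma rec_fun_minus [recs]:
  assumes "rec_fun B f" "rec_fun B g" shows "rec_fun B (\<lambda>x. f x - g x)"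
proof -
  have pred: "rec_nat 0 (\<lambda>n _. n) m = m - 1" for m :: nat by (cases m) auto
  have "rec_fun B (\<lambda>x. rec_nat 0 (\<lambda>n _. n) x)" by (intro recs)
  then have *: "rec_fun B (\<lambda>x. x - 1)" by (simp only: pred)
  have "rec_nat m (\<lambda>_ r. r - 1) n = m - n" for m n :: nat by (induction n) auto
  moreover have "rec_fun B (\<lambda>x. rec_nat (f x) (\<lambda>_ r. r - 1) (g x))"
    by (intro recs assms rec_fun_comp [OF *])
  ultimately show ?thesis by simp
qed

lemma rec_fun_if [recs]:
  assumes "dec B P" "rec_fun B f" "rec_fun B g"
  shows "rec_fun B (\<lambda>x. if P x then f x else g x)"
proof -
  have "(\<lambda>x. if P x then f x else g x) =
    (\<lambda>x. rec_nat (g x) (\<lambda>_ _. f x) (if P x then 1 else 0))"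
    by auto
  moreover have "rec_fun B \<dots>"
    by (intro recs assms(2,3) assms(1)[unfolded dec_def] rec_fun_comp [OF assms(2)])
  ultimately show ?thesis by simp
qed

lemma dec_const [recs]: "dec B (\<lambda>x. b)"
  unfolding dec_def by (intro recs)

lemma dec_not [recs]:
  assumes "dec B P" shows "dec B (\<lambda>x. \<not> P x)"
proof -
  have "rec_fun B (\<lambda>x. if P x then 0 else 1)" by (intro recs assms)
  moreover have "(\<lambda>x. if P x then 0 else 1) = (\<lambda>x. if \<not> P x then 1 else (0::nat))" by auto
  ultimately show ?thesis by (simp add: dec_def)
qed

lemma dec_conj [recs]:
  assumes "dec B P" "dec B Q" shows "dec B (\<lambda>x. P x \<and> Q x)"
proof -
  have "rec_fun B (\<lambda>x. if P x then if Q x then 1 else 0 else 0)" by (intro recs assms)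
  moreover have "(\<lambda>x. if P x then if Q x then 1 else 0 else 0) =
    (\<lambda>x. if P x \<and> Q x then 1 else (0::nat))" by auto
  ultimately show ?thesis by (simp add: dec_def)
qed

lemma dec_disj [recs]:
  assumes "dec B P" "dec B Q" shows "dec B (\<lambda>x. P x \<or> Q x)"
  using dec_not [OF dec_conj [OF dec_not [OF assms(1)] dec_not [OF assms(2)]]] by simp

lemma dec_imp [recs]:
  assumes "dec B P" "dec B Q" shows "dec B (\<lambda>x. P x \<longrightarrow> Q x)"
  unfolding imp_conv_disj by (intro dec_disj dec_not assms)

lemma dec_less [recs]:
  assumes "rec_fun B f" "rec_fun B g" shows "dec B (\<lambda>x. f x < g x)"
proof -
  have "(\<lambda>x. if f x < g x then 1 else (0::nat)) = (\<lambda>x. rec_nat 0 (\<lambda>_ _. 1) (g x - f x))"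
  proof
    fix x
    show "(if f x < g x then 1 else 0) = rec_nat 0 (\<lambda>_ _. 1) (g x - f x)"
      by (cases "g x - f x") auto
  qed
  moreover have "rec_fun B \<dots>" by (intro recs assms)
  ultimately show ?thesis unfolding dec_def by simp
qed

lemma dec_le [recs]:
  assumes "rec_fun B f" "rec_fun B g" shows "dec B (\<lambda>x. f x \<le> g x)"
  using dec_not [OF dec_less [OF assms(2,1)]] by (simp add: not_less)

lemma dec_eq [recs]:
  fixes f g :: "nat \<Rightarrow> nat"
  assumes "rec_fun B f" "rec_fun B g" shows "dec B (\<lambda>x. f x = g x)"
  using dec_conj [OF dec_le [OF assms] dec_le [OF assms(2,1)]] by (simp add: eq_iff)

lemma rec_fun_card [recs]:
  assumes "rec_fun B b" "dec B (\<lambda>w. P (proj1 w) (proj2 w))"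
  shows "rec_fun B (\<lambda>x. card {n. n < b x \<and> P x n})"
proof -
  have "rec_nat 0 (\<lambda>n r. if P x n then Suc r else r) m = card {n. n < m \<and> P x n}" for x m
  proof (induction m)
    case (Suc m)
    have "{n. n < Suc m \<and> P x n} =
      (if P x m then insert m {n. n < m \<and> P x n} else {n. n < m \<and> P x n})"
      by (auto simp: less_Suc_eq)
    then show ?case using Suc by simp
  qed simp
  moreover have
    "dec B (\<lambda>w. P (proj1 w) (proj1 (proj2 w)))"
    using dec_comp [OF assms(2), of "\<lambda>w. prod_encode (proj1 w, proj1 (proj2 w))"]
    by (simp add: recs)
  then have "rec_fun B (\<lambda>x. rec_nat 0 (\<lambda>n r. if P x n then Suc r else r) (b x))"
    by (intro recs assms(1))
  ultimately show ?thesis by simp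
qed

lemma dec_all_less [recs]:
  assumes "rec_fun B b" "dec B (\<lambda>w. P (proj1 w) (proj2 w))"
  shows "dec B (\<lambda>x. \<forall>n. n < b x \<longrightarrow> P x n)"
proof -
  have "dec B (\<lambda>x. card {n. n < b x \<and> \<not> P x n} = 0)"
    by (intro recs assms)
  then show ?thesis by (auto simp: dec_def cong: if_cong)
qed

lemma dec_ex_less [recs]:
  assumes "rec_fun B b" "dec B (\<lambda>w. P (proj1 w) (proj2 w))"
  shows "dec B (\<lambda>x. \<exists>n. n < b x \<and> P x n)"
  using dec_not [OF dec_all_less [OF assms(1) dec_not [OF assms(2)]]] by simp

lemma dec_all_le [recs]:
  assumes "rec_fun B b" "dec B (\<lambda>w. P (proj1 w) (proj2 w))"
  shows "dec B (\<lambda>x. \<forall>n. n \<le> b x \<longrightarrow> P x n)"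
  using dec_all_less [OF rec_fun_Suc [OF assms(1)] assms(2)] by (simp add: less_Suc_eq_le)

lemma computes_Mu:
  assumes "\<And>w. computes B p w (f w)"
  shows "computes B (Mu p) x n \<longleftrightarrow> f (prod_encode (x, n)) = 0 \<and> (\<forall>m<n. f (prod_encode (x, m)) \<noteq> 0)"
    (is "?l \<longleftrightarrow> ?r")
proof
  assume ?l
  then show ?r
  proof cases
    case mu
    have "f (prod_encode (x, n)) = 0"
      using mu(1) assms computes_functional by blast
    moreover have "f (prod_encode (x, m)) \<noteq> 0" if m: "m < n" for m
    proof -
      obtain k where "computes B p (prod_encode (x, m)) (Suc k)" using mu(2) m by blast
      then have "f (prod_encode (x, m)) = Suc k" using assms computes_functional by blast
      then show ?thesis by simp
    qed
    ultimately show ?thesis by blast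
  qed
next
  assume r: ?r
  show ?l
  proof (rule computes.mu)
    show "computes B p (prod_encode (x, n)) 0"
      using assms [of "prod_encode (x, n)"] r by simp
    fix m assume "m < n"
    then have "f (prod_encode (x, m)) \<noteq> 0" using r by blast
    then obtain k where "f (prod_encode (x, m)) = Suc k" using not0_implies_Suc by blast
    then show "\<exists>k. computes B p (prod_encode (x, m)) (Suc k)"
      using assms [of "prod_encode (x, m)"] by auto
  qed
qed

lemma dec_Mu:
  assumes "dec B (\<lambda>w. P (proj1 w) (proj2 w))"
  obtains p where "\<And>x n. computes B p x n \<longleftrightarrow> P x n \<and> (\<forall>m<n. \<not> P x m)"
proof -
  have "rec_fun B (\<lambda>w. if \<not> P (proj1 w) (proj2 w) then 1 else 0)"
    by (fold dec_def) (intro dec_not assms)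
  then obtain p where p: "\<And>w. computes B p w (if \<not> P (proj1 w) (proj2 w) then 1 else 0)"
    unfolding rec_fun_def by (elim exE) blast
  have "computes B (Mu p) x n \<longleftrightarrow> P x n \<and> (\<forall>m<n. \<not> P x m)" for x n
    unfolding computes_Mu [of B p, OF p] by auto
  then show ?thesis by (rule that)
qed

lemma rec_fun_Least:
  assumes "dec B (\<lambda>w. P (proj1 w) (proj2 w))" "\<And>x. \<exists>n. P x n"
  shows "rec_fun B (\<lambda>x. LEAST n. P x n)"
proof -
  obtain p where p: "\<And>x n. computes B p x n \<longleftrightarrow> P x n \<and> (\<forall>m<n. \<not> P x m)"
    using dec_Mu [OF assms(1)] by metis
  have "computes B p x (LEAST n. P x n)" for x
    unfolding p using LeastI_ex [OF assms(2) [of x]] by (auto dest: not_less_Least)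
  then show ?thesis unfolding rec_fun_def by (intro exI allI)
qed

lemma post:
  assumes "dec B (\<lambda>w. R (proj1 w) (proj2 w))" "dec B (\<lambda>w. S (proj1 w) (proj2 w))"
    and R: "\<And>x. P x \<longleftrightarrow> (\<exists>n. R x n)" and S: "\<And>x. \<not> P x \<longleftrightarrow> (\<exists>n. S x n)"
  shows "dec B P"
proof -
  have ex: "\<exists>n. R x n \<or> S x n" for x using R S by blast
  have "rec_fun B (\<lambda>x. LEAST n. R x n \<or> S x n)"
    by (intro rec_fun_Least recs assms(1,2) ex)
  then have "dec B (\<lambda>x. R x (LEAST n. R x n \<or> S x n))"
    using dec_comp [OF assms(1) rec_fun_pair [OF rec_fun_id]] by simp
  moreover have "R x (LEAST n. R x n \<or> S x n) \<longleftrightarrow> P x" for x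
    using LeastI_ex [OF ex [of x]] R [of x] S [of x] by blast
  ultimately show ?thesis by simp
qed

lemma dec_ex_halts:
  assumes "dec B (\<lambda>w. P (proj1 w) (proj2 w))"
  obtains p where "\<And>x. halts B p x \<longleftrightarrow> (\<exists>n. P x n)"
proof -
  obtain p where p: "\<And>x n. computes B p x n \<longleftrightarrow> P x n \<and> (\<forall>m<n. \<not> P x m)"
    using dec_Mu [OF assms] by metis
  have "halts B p x \<longleftrightarrow> (\<exists>n. P x n)" for x
    unfolding halts_def p using exists_least_iff [of "P x"] by blast
  then show ?thesis by (rule that)
qed


lemma dec_mem: "dec B (\<lambda>x. x \<in> B)"
  unfolding dec_def rec_fun_def by (metis computes.query)

subsection \<open>Reductions to the jump\<close>

primrec const_prog :: "nat \<Rightarrow> prog" where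
  "const_prog 0 = Zero"
| "const_prog (Suc n) = Comp Succ (const_prog n)"

lemma computes_const_prog: "computes B (const_prog n) x n"
  by (induction n) (auto intro: computes.intros)

lemma halts_const_prog: "halts B (Comp p (const_prog n)) x \<longleftrightarrow> halts B p n"
proof
  assume "halts B (Comp p (const_prog n)) x"
  then obtain z where "computes B (Comp p (const_prog n)) x z" unfolding halts_def ..
  then show "halts B p n"
  proof cases
    case (comp y)
    have "y = n" using comp(1) computes_const_prog by (rule computes_functional)
    then show ?thesis using comp(2) unfolding halts_def by blast
  qed
next
  assume "halts B p n"
  then show "halts B (Comp p (const_prog n)) x"
    unfolding halts_def by (blast intro: computes.comp computes_const_prog)
qed

lemma rec_fun_code_const_prog: "rec_fun B (\<lambda>n. prog_code (const_prog n))"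
proof -
  have "prog_code (const_prog n) =
    rec_nat (prog_code Zero) (\<lambda>_ r. prod_encode (6, prod_encode (prog_code Succ, r))) n" for n
    by (induction n) auto
  moreover have "rec_fun B
    (\<lambda>n. rec_nat (prog_code Zero) (\<lambda>_ r. prod_encode (6, prod_encode (prog_code Succ, r))) n)"
    by (intro recs)
  ultimately show ?thesis by presburger
qed

lemma dec_jump_halts: "dec (jump B) (\<lambda>x. halts B p x)"
proof -
  have "halts B p x \<longleftrightarrow>
      prod_encode (6, prod_encode (prog_code p, prog_code (const_prog x))) \<in> jump B" (is "_ \<longleftrightarrow> ?c \<in> _") for x
  proof -
    have c: "?c = prog_code (Comp p (const_prog x))" by simp
    have "?c \<in> jump B \<longleftrightarrow> halts B (Comp p (const_prog x)) ?c"
      unfolding c by (auto simp: jump_def prog_code_inject simp del: prog_code.simps)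
    then show ?thesis by (simp only: halts_const_prog)
  qed
  moreover have "dec (jump B)
      (\<lambda>x. prod_encode (6, prod_encode (prog_code p, prog_code (const_prog x))) \<in> jump B)"
    by (intro dec_comp [OF dec_mem] recs rec_fun_code_const_prog)
  ultimately show ?thesis by presburger
qed

lemma dec_jump_ex:
  assumes "dec B (\<lambda>w. P (proj1 w) (proj2 w))"
  shows "dec (jump B) (\<lambda>x. \<exists>n. P x n)"
proof -
  obtain p where p: "\<And>x. halts B p x \<longleftrightarrow> (\<exists>n. P x n)"
    using dec_ex_halts [OF assms] by metis
  show ?thesis using dec_jump_halts [of B p] by (simp only: p)
qed

primrec subst_query :: "prog \<Rightarrow> prog \<Rightarrow> prog" where
  "subst_query r Zero = Zero"
| "subst_query r Succ = Succ"
| "subst_query r Left = Left"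
| "subst_query r Right = Right"
| "subst_query r Query = r"
| "subst_query r (Pairing p q) = Pairing (subst_query r p) (subst_query r q)"
| "subst_query r (Comp p q) = Comp (subst_query r p) (subst_query r q)"
| "subst_query r (Prec p q) = Prec (subst_query r p) (subst_query r q)"
| "subst_query r (Mu p) = Mu (subst_query r p)"

lemma computes_subst_query:
  assumes "\<And>x. computes B r x (if x \<in> A then 1 else 0)"
  shows "computes A p x y \<Longrightarrow> computes B (subst_query r p) x y"
proof (induction rule: computes.induct)
  case (query x)
  show ?case using assms [of x] by (simp only: subst_query.simps)
next
  case (mu p x n)
  then show ?case by (auto intro!: computes.mu)
qed (auto intro: computes.intros)

lemma turing_reducible_trans:
  "turing_reducible A B \<Longrightarrow> turing_reducible C A \<Longrightarrow> turing_reducible C B"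
  unfolding turing_reducible_def by (meson computes_subst_query)

lemma turing_degree_eqI:
  assumes "turing_reducible A B" "turing_reducible B A"
  shows "turing_degree A = turing_degree B"
  unfolding turing_degree_def turing_equivalent_def
  using assms turing_reducible_trans by blast

lemma dec_empty:
  assumes "dec {} P" shows "dec B P"
proof -
  have "dec B (\<lambda>x. x \<in> {})" by (simp only: empty_iff) (rule dec_const)
  then have "turing_reducible {} B" by (simp only: turing_reducible_iff_dec)
  moreover have "turing_reducible {x. P x} {}" using assms by (simp only: turing_reducible_iff_dec mem_Collect_eq)
  ultimately have "turing_reducible {x. P x} B" by (rule turing_reducible_trans)
  then show ?thesis by (simp only: turing_reducible_iff_dec mem_Collect_eq)
qed

subsection \<open>Derivations as finite sets of codes\<close>

lemma mem_set_decode_iff: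
  "n \<in> set_decode D \<longleftrightarrow> (\<exists>q. q < Suc D \<and> (\<exists>r. r < 2 ^ n \<and> D = (2 * q + 1) * 2 ^ n + r))"
proof
  assume "n \<in> set_decode D"
  then have "odd (D div 2 ^ n)" by (simp add: set_decode_def)
  then obtain q where q: "D div 2 ^ n = 2 * q + 1" by (rule oddE)
  have "D = (2 * q + 1) * 2 ^ n + D mod 2 ^ n" unfolding q [symmetric] by (rule div_mult_mod_eq [symmetric])
  moreover have "q < Suc D" using q div_le_dividend [of D "2 ^ n"] by linarith
  moreover have "D mod 2 ^ n < 2 ^ n" by simp
  ultimately show "\<exists>q. q < Suc D \<and> (\<exists>r. r < 2 ^ n \<and> D = (2 * q + 1) * 2 ^ n + r)" by blast
next
  assume "\<exists>q. q < Suc D \<and> (\<exists>r. r < 2 ^ n \<and> D = (2 * q + 1) * 2 ^ n + r)"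
  then obtain q r where "r < 2 ^ n" "D = (2 * q + 1) * 2 ^ n + r" by blast
  then have "D div 2 ^ n = (r + (2 * q + 1) * 2 ^ n) div 2 ^ n" by (simp only: add.commute)
  also have "\<dots> = 2 * q + 1" using \<open>r < 2 ^ n\<close> by (subst div_mult_self1) simp_all
  finally have "D div 2 ^ n = 2 * q + 1" .
  then show "n \<in> set_decode D" by (simp add: set_decode_def)
qed

lemma mem_set_decode_less:
  assumes "n \<in> set_decode D" shows "n < D"
proof (rule ccontr)
  assume "\<not> n < D"
  then have "D < 2 ^ n" using less_exp [of n] by linarith
  then show False using assms by (simp add: set_decode_def)
qed

lemma dec_mem_set_decode [recs]:
  assumes "rec_fun B f" "rec_fun B g"
  shows "dec B (\<lambda>x. f x \<in> set_decode (g x))"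
  unfolding mem_set_decode_iff
  by (intro recs rec_fun_comp [OF assms(1)] rec_fun_comp [OF assms(2)] assms)

lemma dec_ball_set_decode [recs]:
  assumes "rec_fun B f" "dec B (\<lambda>w. P (proj1 w) (proj2 w))"
  shows "dec B (\<lambda>x. \<forall>t\<in>set_decode (f x). P x t)"
proof -
  have "(\<forall>t\<in>set_decode (f x). P x t) \<longleftrightarrow> (\<forall>t. t < f x \<longrightarrow> t \<in> set_decode (f x) \<longrightarrow> P x t)" for x
    using mem_set_decode_less by blast
  moreover have "dec B (\<lambda>x. \<forall>t. t < f x \<longrightarrow> t \<in> set_decode (f x) \<longrightarrow> P x t)"
    by (intro recs rec_fun_comp [OF assms(1)] assms)
  ultimately show ?thesis by simp
qed

definition triple :: "nat \<Rightarrow> nat \<Rightarrow> nat \<Rightarrow> nat" where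
  "triple c x y = prod_encode (c, prod_encode (x, y))"

lemma rec_fun_triple [recs]:
  "rec_fun B f \<Longrightarrow> rec_fun B g \<Longrightarrow> rec_fun B h \<Longrightarrow> rec_fun B (\<lambda>x. triple (f x) (g x) (h x))"
  unfolding triple_def by (intro recs)

lemma triple_eq_iff [simp]: "triple c x y = triple c' x' y' \<longleftrightarrow> c = c' \<and> x = x' \<and> y = y'"
  by (simp add: triple_def prod_encode_eq)

text \<open>
  A finite set closed under backward justification needs no well-foundedness condition: each premise
  of a rule concerns a smaller program or the same recursion at a smaller argument. The answers to
  oracle queries are checked separately, by \<open>oracle_ok\<close>.
\<close>

definition justified :: "nat set \<Rightarrow> nat \<Rightarrow> nat \<Rightarrow> nat \<Rightarrow> bool" where
  "justified S c x y \<longleftrightarrow>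
    c = prod_encode (0, 0) \<and> y = 0 \<or>
    c = prod_encode (1, 0) \<and> y = Suc x \<or>
    c = prod_encode (2, 0) \<and> y = proj1 x \<or>
    c = prod_encode (3, 0) \<and> y = proj2 x \<or>
    c = prod_encode (4, 0) \<and> y \<le> 1 \<or>
    proj1 c = 5 \<and> triple (proj1 (proj2 c)) x (proj1 y) \<in> S \<and> triple (proj2 (proj2 c)) x (proj2 y) \<in> S \<or>
    proj1 c = 6 \<and> (\<exists>z. triple (proj2 (proj2 c)) x z \<in> S \<and> triple (proj1 (proj2 c)) z y \<in> S) \<or>
    proj1 c = 7 \<and> proj2 x = 0 \<and> triple (proj1 (proj2 c)) (proj1 x) y \<in> S \<or>
    proj1 c = 7 \<and> 0 < proj2 x \<and>
      (\<exists>z. triple c (prod_encode (proj1 x, proj2 x - 1)) z \<in> S \<and>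
        triple (proj2 (proj2 c)) (prod_encode (proj1 x, prod_encode (proj2 x - 1, z))) y \<in> S) \<or>
    proj1 c = 8 \<and> triple (proj2 c) (prod_encode (x, y)) 0 \<in> S \<and>
      (\<forall>m<y. \<exists>z. triple (proj2 c) (prod_encode (x, m)) (Suc z) \<in> S)"

lemma justified_mono:
  assumes "S \<subseteq> T" "justified S c x y" shows "justified T c x y"
  using assms(2) subsetD [OF assms(1)] unfolding justified_def by metis

definition derivation :: "nat set \<Rightarrow> bool" where
  "derivation S \<longleftrightarrow> (\<forall>t\<in>S. justified S (proj1 t) (proj1 (proj2 t)) (proj2 (proj2 t)))"

definition oracle_ok :: "nat set \<Rightarrow> nat set \<Rightarrow> bool" where
  "oracle_ok B S \<longleftrightarrow> (\<forall>t\<in>S. proj1 t = prod_encode (4, 0) \<longrightarrow>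
     proj2 (proj2 t) = (if proj1 (proj2 t) \<in> B then 1 else 0))"

lemma derivation_sound:
  assumes S: "derivation S" "oracle_ok B S"
  shows "triple (prog_code p) x y \<in> S \<Longrightarrow> computes B p x y"
proof (induction p arbitrary: x y)
  case (Prec p q)
  have "triple (prog_code (Prec p q)) (prod_encode (a, n)) y \<in> S \<Longrightarrow>
    computes B (Prec p q) (prod_encode (a, n)) y" for a n y
  proof (induction n arbitrary: y)
    case 0
    then have "justified S (prog_code (Prec p q)) (prod_encode (a, 0)) y"
      using S(1) unfolding derivation_def by (force simp: triple_def)
    then show ?case
      using Prec.IH by (auto simp: justified_def prod_encode_eq intro: computes.prec_0)
  next
    case (Suc n)
    then have "justified S (prog_code (Prec p q)) (prod_encode (a, Suc n)) y"
      using S(1) unfolding derivation_def by (force simp: triple_def)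
    then obtain z where "triple (prog_code (Prec p q)) (prod_encode (a, n)) z \<in> S"
      "triple (prog_code q) (prod_encode (a, prod_encode (n, z))) y \<in> S"
      by (auto simp: justified_def prod_encode_eq)
    then show ?case using Suc.IH Prec.IH(2) by (blast intro: computes.prec_Suc)
  qed
  from this [of "proj1 x" "proj2 x" y] show ?case using Prec.prems by simp
next
  case (Mu p)
  then have "justified S (prog_code (Mu p)) x y"
    using S(1) unfolding derivation_def by (force simp: triple_def)
  then have "triple (prog_code p) (prod_encode (x, y)) 0 \<in> S"
    "\<forall>m<y. \<exists>z. triple (prog_code p) (prod_encode (x, m)) (Suc z) \<in> S"
    by (simp_all add: justified_def prod_encode_eq)
  then show ?case by (intro computes.mu) (use Mu.IH in blast)+
next
  case (Comp p q)
  then have "justified S (prog_code (Comp p q)) x y"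
    using S(1) unfolding derivation_def by (force simp: triple_def)
  then obtain z where "triple (prog_code q) x z \<in> S" "triple (prog_code p) z y \<in> S"
    by (auto simp: justified_def prod_encode_eq)
  then show ?case using Comp.IH by (blast intro: computes.comp)
next
  case (Pairing p q)
  then have "justified S (prog_code (Pairing p q)) x y"
    using S(1) unfolding derivation_def by (force simp: triple_def)
  then have "computes B p x (proj1 y)" "computes B q x (proj2 y)"
    using Pairing.IH by (auto simp: justified_def prod_encode_eq)
  from computes.pair [OF this] show ?case by simp
next
  case Query
  then have "y = (if x \<in> B then 1 else 0)"
    using S(2) unfolding oracle_ok_def by (force simp: triple_def)
  then show ?case using computes.query by metis
next
  case Zero
  then have "justified S (prog_code Zero) x y"
    using S(1) unfolding derivation_def by (force simp: triple_def)
  then show ?case by (auto simp: justified_def prod_encode_eq intro: computes.intros)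
next
  case Succ
  then have "justified S (prog_code Succ) x y"
    using S(1) unfolding derivation_def by (force simp: triple_def)
  then show ?case by (auto simp: justified_def prod_encode_eq intro: computes.intros)
next
  case Left
  then have "justified S (prog_code Left) x y"
    using S(1) unfolding derivation_def by (force simp: triple_def)
  then have "y = proj1 x" by (auto simp: justified_def prod_encode_eq)
  then show ?case using computes.left [of B "proj1 x" "proj2 x"] by simp
next
  case Right
  then have "justified S (prog_code Right) x y"
    using S(1) unfolding derivation_def by (force simp: triple_def)
  then have "y = proj2 x" by (auto simp: justified_def prod_encode_eq)
  then show ?case using computes.right [of B "proj1 x" "proj2 x"] by simp
qed

definition true_derivation :: "nat set \<Rightarrow> nat set \<Rightarrow> bool" where
  "true_derivation B S \<longleftrightarrow> finite S \<and> derivation S \<and> oracle_ok B S"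

lemma true_derivation_UN:
  assumes "finite I" "\<And>i. i \<in> I \<Longrightarrow> true_derivation B (S i)"
  shows "true_derivation B (\<Union>i\<in>I. S i)"
  using assms unfolding true_derivation_def derivation_def oracle_ok_def
  by (auto intro: justified_mono [rotated])

lemma true_derivation_Un:
  "true_derivation B S \<Longrightarrow> true_derivation B T \<Longrightarrow> true_derivation B (S \<union> T)"
  unfolding true_derivation_def derivation_def oracle_ok_def
  by (auto intro: justified_mono [rotated])

lemma true_derivation_empty: "true_derivation B {}"
  by (simp add: true_derivation_def derivation_def oracle_ok_def)

lemma true_derivation_insert:
  assumes "true_derivation B S" "justified S c x y"
    and "c = prod_encode (4, 0) \<Longrightarrow> y = (if x \<in> B then 1 else 0)"
  shows "true_derivation B (insert (triple c x y) S)"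
proof -
  have "justified (insert (triple c x y) S) c' x' y'" if "justified S c' x' y'" for c' x' y'
    using justified_mono [OF subset_insertI that] .
  then show ?thesis
    using assms unfolding true_derivation_def derivation_def oracle_ok_def
    by (auto simp: triple_def)
qed

lemma true_derivation_step:
  assumes "true_derivation B S" "justified S c x y" "c \<noteq> prod_encode (4, 0)"
  shows "\<exists>T. true_derivation B T \<and> triple c x y \<in> T"
  using true_derivation_insert [OF assms(1,2)] assms(3) by blast

lemma derivation_complete:
  "computes B p x y \<Longrightarrow> \<exists>S. true_derivation B S \<and> triple (prog_code p) x y \<in> S"
proof (induction rule: computes.induct)
  case (pair p x y q z)
  then obtain S T where "true_derivation B S" "triple (prog_code p) x y \<in> S"
    "true_derivation B T" "triple (prog_code q) x z \<in> T" by blast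
  then have "true_derivation B (S \<union> T)"
    "justified (S \<union> T) (prog_code (Pairing p q)) x (prod_encode (y, z))"
    by (auto intro: true_derivation_Un simp: justified_def)
  then show ?case
    by (rule true_derivation_step) (simp add: prod_encode_eq)
next
  case (comp q x y p z)
  then obtain S T where "true_derivation B S" "triple (prog_code q) x y \<in> S"
    "true_derivation B T" "triple (prog_code p) y z \<in> T" by blast
  then have "true_derivation B (S \<union> T)"
    "justified (S \<union> T) (prog_code (Comp p q)) x z"
    by (auto intro: true_derivation_Un simp: justified_def)
  then show ?case
    by (rule true_derivation_step) (simp add: prod_encode_eq)
next
  case (prec_0 p x y q)
  then obtain S where "true_derivation B S" "triple (prog_code p) x y \<in> S" by blast
  then have "true_derivation B S"
    "justified S (prog_code (Prec p q)) (prod_encode (x, 0)) y"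
    by (auto simp: justified_def)
  then show ?case
    by (rule true_derivation_step) (simp add: prod_encode_eq)
next
  case (prec_Suc p q x n y z)
  then obtain S T where "true_derivation B S" "triple (prog_code (Prec p q)) (prod_encode (x, n)) y \<in> S"
    "true_derivation B T" "triple (prog_code q) (prod_encode (x, prod_encode (n, y))) z \<in> T" by blast
  then have "true_derivation B (S \<union> T)"
    "justified (S \<union> T) (prog_code (Prec p q)) (prod_encode (x, Suc n)) z"
    by (auto intro: true_derivation_Un simp: justified_def)
  then show ?case
    by (rule true_derivation_step) (simp add: prod_encode_eq)
next
  case (mu p x n)
  then obtain S where S: "true_derivation B S" "triple (prog_code p) (prod_encode (x, n)) 0 \<in> S"
    by blast
  have "\<forall>m. \<exists>T. m < n \<longrightarrow> true_derivation B T \<and>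
    (\<exists>z. triple (prog_code p) (prod_encode (x, m)) (Suc z) \<in> T)"
    using mu.IH(2) by blast
  then obtain T where T: "\<And>m. m < n \<Longrightarrow> true_derivation B (T m)"
    "\<And>m. m < n \<Longrightarrow> \<exists>z. triple (prog_code p) (prod_encode (x, m)) (Suc z) \<in> T m"
    by metis
  let ?U = "S \<union> (\<Union>m\<in>{..<n}. T m)"
  have "true_derivation B ?U"
    using S(1) T(1) by (intro true_derivation_Un true_derivation_UN) auto
  moreover have "justified ?U (prog_code (Mu p)) x n"
    using S(2) T(2) unfolding justified_def by (simp add: prod_encode_eq) blast
  ultimately show ?case
    by (rule true_derivation_step) (simp add: prod_encode_eq)
next
  case (query x)
  have "justified {} (prog_code Query) x (if x \<in> B then 1 else 0)" by (simp add: justified_def)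
  from true_derivation_insert [OF true_derivation_empty this] show ?case
    by (intro exI conjI) auto
next
  case (zero x)
  have "justified {} (prog_code Zero) x 0" by (simp add: justified_def)
  with true_derivation_empty show ?case
    by (rule true_derivation_step) (simp add: prod_encode_eq)
next
  case (succ x)
  have "justified {} (prog_code Succ) x (Suc x)" by (simp add: justified_def)
  with true_derivation_empty show ?case
    by (rule true_derivation_step) (simp add: prod_encode_eq)
next
  case (left x y)
  have "justified {} (prog_code Left) (prod_encode (x, y)) x" by (simp add: justified_def)
  with true_derivation_empty show ?case
    by (rule true_derivation_step) (simp add: prod_encode_eq)
next
  case (right x y)
  have "justified {} (prog_code Right) (prod_encode (x, y)) y" by (simp add: justified_def)
  with true_derivation_empty show ?case
    by (rule true_derivation_step) (simp add: prod_encode_eq)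
qed


text \<open>
  Justification never inspects subprograms that are not run, such as the step of a recursion of
  length \<open>0\<close>, so being the code of a program is certified by a second finite set.
\<close>

definition wf_codes :: "nat set \<Rightarrow> bool" where
  "wf_codes S \<longleftrightarrow> (\<forall>c\<in>S. proj1 c < 5 \<and> proj2 c = 0 \<or>
    5 \<le> proj1 c \<and> proj1 c \<le> 7 \<and> proj1 (proj2 c) \<in> S \<and> proj2 (proj2 c) \<in> S \<or>
    proj1 c = 8 \<and> proj2 c \<in> S)"

lemma less_prod_encode:
  assumes "0 < a" shows "b < prod_encode (a, b)"
proof -
  have "n \<le> triangle n" for n by (induction n) auto
  from this [of "a + b"] assms show ?thesis by (simp add: prod_encode_def)
qed

lemma proj_le: "proj1 c \<le> c" "proj2 c \<le> c"
  using le_prod_encode_1 [of "proj1 c" "proj2 c"] le_prod_encode_2 [of "proj2 c" "proj1 c"] by simp_all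

lemma wf_codes_sound:
  assumes "wf_codes S"
  shows "c \<in> S \<Longrightarrow> \<exists>p. c = prog_code p"
proof (induction c rule: less_induct)
  case (less c)
  have c: "c = prod_encode (proj1 c, proj2 c)" by simp
  consider "proj1 c < 5" "proj2 c = 0" |
    "5 \<le> proj1 c" "proj1 c \<le> 7" "proj1 (proj2 c) \<in> S" "proj2 (proj2 c) \<in> S" |
    "proj1 c = 8" "proj2 c \<in> S"
    using bspec [OF assms [unfolded wf_codes_def] less.prems] by metis
  then show ?case
  proof cases
    case 1
    then consider "proj1 c = 0" | "proj1 c = 1" | "proj1 c = 2" | "proj1 c = 3" | "proj1 c = 4"
      by linarith
    then show ?thesis
      using c 1(2) by cases (metis prog_code.simps(1-5))+
  next
    case 2
    have "proj2 c < c" using less_prod_encode [of "proj1 c" "proj2 c"] 2(1) unfolding prod_encode_proj by simp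
    then obtain p q where "proj1 (proj2 c) = prog_code p" "proj2 (proj2 c) = prog_code q"
      using less.IH 2(3,4) proj_le [of "proj2 c"] by (meson le_less_trans)
    then have "proj2 c = prod_encode (prog_code p, prog_code q)" by (metis prod_encode_proj)
    moreover consider "proj1 c = 5" | "proj1 c = 6" | "proj1 c = 7" using 2(1,2) by linarith
    ultimately show ?thesis
      using c by cases (metis prog_code.simps(6-8))+
  next
    case 3
    have "proj2 c < c" using less_prod_encode [of "proj1 c" "proj2 c"] 3(1) unfolding prod_encode_proj by simp
    then obtain p where "proj2 c = prog_code p" using less.IH 3(2) by blast
    then show ?thesis using c 3(1) by (metis prog_code.simps(9))
  qed
qed

lemma wf_codes_insert2:
  assumes "wf_codes S" "wf_codes T" "a \<in> S" "b \<in> T" "5 \<le> k" "k \<le> 7"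
  shows "wf_codes (insert (prod_encode (k, prod_encode (a, b))) (S \<union> T))"
  using assms unfolding wf_codes_def by (simp add: ball_Un) blast

lemma wf_codes_singleton:
  assumes "k < 5" shows "\<exists>S. finite S \<and> wf_codes S \<and> prod_encode (k, 0) \<in> S"
  using assms by (intro exI [of _ "{prod_encode (k, 0)}"]) (simp add: wf_codes_def)

lemma wf_codes_complete: "\<exists>S. finite S \<and> wf_codes S \<and> prog_code p \<in> S"
proof (induction p)
  case (Pairing p q)
  then obtain S T where "finite S" "wf_codes S" "prog_code p \<in> S"
    "finite T" "wf_codes T" "prog_code q \<in> T" by blast
  then show ?case
    by (intro exI [of _ "insert (prog_code (Pairing p q)) (S \<union> T)"]) (simp add: wf_codes_insert2)
next
  case (Comp p q)
  then obtain S T where "finite S" "wf_codes S" "prog_code p \<in> S"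
    "finite T" "wf_codes T" "prog_code q \<in> T" by blast
  then show ?case
    by (intro exI [of _ "insert (prog_code (Comp p q)) (S \<union> T)"]) (simp add: wf_codes_insert2)
next
  case (Prec p q)
  then obtain S T where "finite S" "wf_codes S" "prog_code p \<in> S"
    "finite T" "wf_codes T" "prog_code q \<in> T" by blast
  then show ?case
    by (intro exI [of _ "insert (prog_code (Prec p q)) (S \<union> T)"]) (simp add: wf_codes_insert2)
next
  case (Mu p)
  then obtain S where "finite S" "wf_codes S" "prog_code p \<in> S" by blast
  then show ?case
    by (intro exI [of _ "insert (prog_code (Mu p)) S"]) (auto simp: wf_codes_def)
qed (simp_all add: wf_codes_singleton)

definition run :: "nat \<Rightarrow> nat \<Rightarrow> bool" where
  "run e w \<longleftrightarrow> wf_codes (set_decode (proj2 w)) \<and> e \<in> set_decode (proj2 w) \<and>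
    derivation (set_decode (proj1 w)) \<and> (\<exists>y. triple e e y \<in> set_decode (proj1 w))"

lemma jump_iff: "e \<in> jump B \<longleftrightarrow> (\<exists>w. run e w \<and> oracle_ok B (set_decode (proj1 w)))"
proof
  assume "e \<in> jump B"
  then obtain p y where p: "e = prog_code p" "computes B p e y"
    unfolding jump_def halts_def by blast
  obtain S where S: "true_derivation B S" "triple e e y \<in> S"
    using derivation_complete [OF p(2)] p(1) by blast
  obtain T where T: "finite T" "wf_codes T" "e \<in> T"
    using wf_codes_complete p(1) by blast
  have "run e (prod_encode (set_encode S, set_encode T))"
    using S T by (auto simp: run_def true_derivation_def set_encode_inverse)
  moreover have "oracle_ok B (set_decode (set_encode S))"
    using S by (simp add: true_derivation_def set_encode_inverse)
  ultimately show "\<exists>w. run e w \<and> oracle_ok B (set_decode (proj1 w))" by (metis proj_prod_encode(1))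
next
  assume "\<exists>w. run e w \<and> oracle_ok B (set_decode (proj1 w))"
  then obtain w where w: "run e w" "oracle_ok B (set_decode (proj1 w))" by blast
  then obtain p where p: "e = prog_code p" using wf_codes_sound unfolding run_def by blast
  then have "halts B p e"
    using w derivation_sound unfolding run_def halts_def by blast
  then show "e \<in> jump B" using p unfolding jump_def by blast
qed

lemma triple_mem_less:
  assumes "triple c x y \<in> set_decode D" shows "y < D"
proof -
  have "y \<le> triple c x y"
    unfolding triple_def using le_prod_encode_2 order.trans by blast
  then show ?thesis using mem_set_decode_less [OF assms] by simp
qed

lemma dec_ex_triple:
  assumes "rec_fun B c" "rec_fun B a" "rec_fun B d" "dec B (\<lambda>w. P (proj1 w) (proj2 w))"
  shows "dec B (\<lambda>x. \<exists>z. triple (c x) (a x) z \<in> set_decode (d x) \<and> P x z)"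
proof -
  have "(\<exists>z. triple (c x) (a x) z \<in> set_decode (d x) \<and> P x z) \<longleftrightarrow>
    (\<exists>z. z < d x \<and> triple (c x) (a x) z \<in> set_decode (d x) \<and> P x z)" for x
    using triple_mem_less by blast
  moreover have "dec B (\<lambda>x. \<exists>z. z < d x \<and> triple (c x) (a x) z \<in> set_decode (d x) \<and> P x z)"
    by (intro recs assms rec_fun_comp [OF assms(1)] rec_fun_comp [OF assms(2)] rec_fun_comp [OF assms(3)])
  ultimately show ?thesis by presburger
qed

lemma dec_ex_triple_Suc:
  assumes "rec_fun B c" "rec_fun B a" "rec_fun B d"
  shows "dec B (\<lambda>x. \<exists>z. triple (c x) (a x) (Suc z) \<in> set_decode (d x))"
proof -
  have "(\<exists>z. triple (c x) (a x) (Suc z) \<in> set_decode (d x)) \<longleftrightarrow>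
    (\<exists>z. triple (c x) (a x) z \<in> set_decode (d x) \<and> 0 < z)" for x
    by (metis gr0_conv_Suc)
  moreover have "dec B (\<lambda>x. \<exists>z. triple (c x) (a x) z \<in> set_decode (d x) \<and> 0 < z)"
    by (intro dec_ex_triple recs assms)
  ultimately show ?thesis by presburger
qed

lemma dec_justified:
  assumes "rec_fun B d" "rec_fun B c" "rec_fun B x" "rec_fun B y"
  shows "dec B (\<lambda>n. justified (set_decode (d n)) (c n) (x n) (y n))"
  unfolding justified_def
  by (intro recs dec_ex_triple dec_ex_triple_Suc assms assms [THEN rec_fun_comp])

lemma dec_derivation:
  assumes "rec_fun B d" shows "dec B (\<lambda>x. derivation (set_decode (d x)))"
  unfolding derivation_def by (intro recs dec_justified assms assms [THEN rec_fun_comp])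

lemma dec_wf_codes:
  assumes "rec_fun B d" shows "dec B (\<lambda>x. wf_codes (set_decode (d x)))"
  unfolding wf_codes_def by (intro recs assms assms [THEN rec_fun_comp])

lemma dec_run:
  assumes "rec_fun B f" "rec_fun B g" shows "dec B (\<lambda>x. run (f x) (g x))"
proof -
  have "run e w \<longleftrightarrow> wf_codes (set_decode (proj2 w)) \<and> e \<in> set_decode (proj2 w) \<and>
    derivation (set_decode (proj1 w)) \<and> (\<exists>y. triple e e y \<in> set_decode (proj1 w) \<and> True)" for e w
    by (simp add: run_def)
  moreover have "dec B (\<lambda>x. wf_codes (set_decode (proj2 (g x))) \<and> f x \<in> set_decode (proj2 (g x)) \<and>
    derivation (set_decode (proj1 (g x))) \<and> (\<exists>y. triple (f x) (f x) y \<in> set_decode (proj1 (g x)) \<and> True))"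
    by (intro recs dec_ex_triple dec_wf_codes dec_derivation assms)
  ultimately show ?thesis by presburger
qed

lemma eventually_ex_less: "\<forall>\<^sub>F k::nat in sequentially. (\<exists>n. P n) \<longrightarrow> (\<exists>n. n < k \<and> P n)"
proof (cases "\<exists>n. P n")
  case True
  then obtain n where "P n" by blast
  then show ?thesis by (auto intro: eventually_mono [OF eventually_gt_at_top [of n]])
qed simp

definition halts_within :: "nat \<Rightarrow> nat \<Rightarrow> bool" where
  "halts_within e w \<longleftrightarrow> run e w \<and> oracle_ok {} (set_decode (proj1 w))"

lemma dec_halts_within:
  assumes "rec_fun B f" "rec_fun B g" shows "dec B (\<lambda>x. halts_within (f x) (g x))"
  unfolding halts_within_def oracle_ok_def by (simp only: empty_iff if_False) (intro recs dec_run assms)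

lemma double_jump_Sigma2:
  obtains Q where "dec {} (\<lambda>w. Q (proj1 w) (proj1 (proj2 w)) (proj2 (proj2 w)))"
    and "\<And>e. e \<in> jump (jump {}) \<longleftrightarrow> (\<exists>u. \<forall>v. \<not> Q e u v)"
proof -
  define Q' where "Q' e u v \<longleftrightarrow> run e (proj1 u) \<and>
    (\<forall>t\<in>set_decode (proj1 (proj1 u)). proj1 t = prod_encode (4, 0) \<longrightarrow> proj2 (proj2 t) \<le> 1 \<and>
      (proj2 (proj2 t) = 1 \<longrightarrow> (\<exists>n. n < proj2 u \<and> halts_within (proj1 (proj2 t)) n)) \<and>
      (proj2 (proj2 t) = 0 \<longrightarrow> \<not> (\<exists>n. n < v \<and> halts_within (proj1 (proj2 t)) n)))" for e u v
  have "dec {} (\<lambda>w. \<not> Q' (proj1 w) (proj1 (proj2 w)) (proj2 (proj2 w)))"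
    unfolding Q'_def by (intro recs dec_run dec_halts_within)
  moreover have "e \<in> jump (jump {}) \<longleftrightarrow> (\<exists>u. \<forall>v. \<not> \<not> Q' e u v)" for e
  proof
    have J: "x \<in> jump {} \<longleftrightarrow> (\<exists>n. halts_within x n)" for x
      unfolding halts_within_def by (rule jump_iff)
    {
      assume "e \<in> jump (jump {})"
      then obtain w where w: "run e w" "oracle_ok (jump {}) (set_decode (proj1 w))"
        using jump_iff by blast
      have "\<forall>\<^sub>F k in sequentially. \<forall>t\<in>set_decode (proj1 w).
        (\<exists>n. halts_within (proj1 (proj2 t)) n) \<longrightarrow> (\<exists>n. n < k \<and> halts_within (proj1 (proj2 t)) n)"
        by (intro eventually_ball_finite ballI eventually_ex_less) simp
      then obtain k where k: "\<forall>t\<in>set_decode (proj1 w).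
        (\<exists>n. halts_within (proj1 (proj2 t)) n) \<longrightarrow> (\<exists>n. n < k \<and> halts_within (proj1 (proj2 t)) n)"
        unfolding eventually_sequentially by blast
      have "Q' e (prod_encode (w, k)) v" for v
        using w k unfolding Q'_def oracle_ok_def J by (auto split: if_splits)
      then show "\<exists>u. \<forall>v. \<not> \<not> Q' e u v" by blast
    next
      assume "\<exists>u. \<forall>v. \<not> \<not> Q' e u v"
      then obtain u where u: "\<And>v. Q' e u v" by blast
      have "oracle_ok (jump {}) (set_decode (proj1 (proj1 u)))"
        unfolding oracle_ok_def J
      proof (intro ballI impI)
        fix t assume t: "t \<in> set_decode (proj1 (proj1 u))" "proj1 t = prod_encode (4, 0)"
        show "proj2 (proj2 t) = (if \<exists>n. halts_within (proj1 (proj2 t)) n then 1 else 0)"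
        proof (cases "\<exists>n. halts_within (proj1 (proj2 t)) n")
          case True
          then obtain n where "halts_within (proj1 (proj2 t)) n" ..
          then have "proj2 (proj2 t) \<noteq> 0" "proj2 (proj2 t) \<le> 1"
            using u [of "Suc n"] t unfolding Q'_def by blast+
          then show ?thesis using True by simp
        next
          case False
          then have "proj2 (proj2 t) \<noteq> 1" "proj2 (proj2 t) \<le> 1"
            using u [of 0] t unfolding Q'_def by blast+
          then show ?thesis using False by simp
        qed
      qed
      moreover have "run e (proj1 u)" using u unfolding Q'_def by blast
      ultimately show "e \<in> jump (jump {})" using jump_iff by blast
    }
  qed
  ultimately show ?thesis by (rule that)
qed


subsection \<open>Two-cohesive sets\<close>

lemma pair_code_doubleton:
  assumes "x < y" shows "pair_code {x, y} = prod_encode (x, y)"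
  using assms by (simp add: pair_code_def)

lemma two_cohesive_coloring:
  assumes A: "two_cohesive A" and C: "dec {} (\<lambda>w. C (proj1 w) (proj2 w))"
  shows "\<exists>N b. \<forall>x\<in>A. \<forall>y\<in>A. N \<le> x \<longrightarrow> x < y \<longrightarrow> ((\<exists>n. C (prod_encode (x, y)) n) \<longleftrightarrow> b)"
proof -
  define c where "c s = (if \<exists>n. C (pair_code s) n then 1 else 0 :: nat)" for s
  have "dec {} (\<lambda>w. proj1 (proj1 w) < proj2 (proj1 w) \<and> C (proj1 w) (proj2 w))"
    by (intro recs C)
  then obtain p where p: "\<And>w. halts {} p w \<longleftrightarrow> (\<exists>n. proj1 w < proj2 w \<and> C w n)"
    by (rule dec_ex_halts) blast
  have "pair_code ` {s \<in> [UNIV]\<^bsup>2\<^esup>. c s = 1} = {w. halts {} p w}"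
  proof (intro equalityI subsetI)
    fix w assume "w \<in> pair_code ` {s \<in> [UNIV]\<^bsup>2\<^esup>. c s = 1}"
    then obtain s where s: "s \<in> [UNIV]\<^bsup>2\<^esup>" "c s = 1" "w = pair_code s" by blast
    then obtain x y where xy: "s = {x, y}" "x < y"
      by (auto simp: nsets_def card_2_iff) (metis doubleton_eq_iff neqE)
    have "\<exists>n. C w n" using s(2,3) unfolding c_def by (metis zero_neq_one)
    then show "w \<in> {w. halts {} p w}"
      using xy s(3) p by (simp add: pair_code_doubleton)
  next
    fix w assume "w \<in> {w. halts {} p w}"
    then have w: "proj1 w < proj2 w" "\<exists>n. C w n" using p by blast+
    let ?s = "{proj1 w, proj2 w}"
    have "pair_code ?s = w" using w(1) by (simp add: pair_code_doubleton)
    moreover have "?s \<in> [UNIV]\<^bsup>2\<^esup>" using w(1) by (simp add: nsets_def)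
    ultimately show "w \<in> pair_code ` {s \<in> [UNIV]\<^bsup>2\<^esup>. c s = 1}"
      using w(2) by (intro image_eqI [of _ _ ?s]) (simp_all add: c_def)
  qed
  then have "ce_set (pair_code ` {s \<in> [UNIV]\<^bsup>2\<^esup>. c s = 1})"
    unfolding ce_set_def by blast
  then have "ce_two_coloring c"
    unfolding ce_two_coloring_def two_coloring_def by (auto simp: c_def)
  then obtain F i where F: "finite F" "\<And>s. s \<in> [A - F]\<^bsup>2\<^esup> \<Longrightarrow> c s = i"
    using A unfolding two_cohesive_def almost_homogeneous_def by blast
  obtain N where N: "F \<subseteq> {..<N}" using finite_nat_bounded [OF F(1)] by blast
  show ?thesis
  proof (intro exI [of _ N] exI [of _ "i = 1"] ballI impI)
    fix x y assume xy: "x \<in> A" "y \<in> A" "N \<le> x" "x < y"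
    then have "{x, y} \<in> [A - F]\<^bsup>2\<^esup>" using N by (auto simp: nsets_def)
    then have "c {x, y} = i" by (rule F(2))
    then show "(\<exists>n. C (prod_encode (x, y)) n) \<longleftrightarrow> i = 1"
      using xy(4) unfolding c_def by (auto simp: pair_code_doubleton split: if_splits)
  qed
qed

lemma infinite_nat_above:
  fixes A :: "nat set"
  assumes "infinite A" obtains x where "x \<in> A" "k < x"
  using assms unfolding infinite_nat_iff_unbounded by blast

lemma dec_two_cohesive_ex:
  assumes A: "two_cohesive A" and H: "dec {} (\<lambda>w. H (proj1 w) (proj2 w))"
  shows "dec A (\<lambda>e. \<exists>n. H e n)"
proof -
  have inf: "infinite A" using A unfolding two_cohesive_def ..
  define C where "C w n \<longleftrightarrow> (\<exists>e. e < proj1 w \<and> H e n \<and> \<not> (\<exists>m. m < proj2 w \<and> H e m))" for w n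
  have H': "rec_fun {} f \<Longrightarrow> rec_fun {} g \<Longrightarrow> dec {} (\<lambda>x. H (f x) (g x))" for f g
    using dec_comp [OF H rec_fun_pair] by simp
  have "dec {} (\<lambda>w. C (proj1 w) (proj2 w))"
    unfolding C_def by (intro recs H')
  from two_cohesive_coloring [OF A this] obtain N b where
    "\<forall>x\<in>A. \<forall>y\<in>A. N \<le> x \<longrightarrow> x < y \<longrightarrow> ((\<exists>n. C (prod_encode (x, y)) n) \<longleftrightarrow> b)"
    by (elim exE)
  note N = this [rule_format]
  have "\<not> b"
  proof -
    obtain x where x: "x \<in> A" "N < x" using infinite_nat_above [OF inf] .
    have "\<forall>\<^sub>F y in sequentially. \<forall>e\<in>{..<x}. (\<exists>n. H e n) \<longrightarrow> (\<exists>n. n < y \<and> H e n)"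
      by (intro eventually_ball_finite ballI eventually_ex_less) simp
    then obtain Y where Y: "\<And>y. Y \<le> y \<Longrightarrow> \<forall>e\<in>{..<x}. (\<exists>n. H e n) \<longrightarrow> (\<exists>n. n < y \<and> H e n)"
      unfolding eventually_sequentially by blast
    obtain y where y: "y \<in> A" "max x Y < y" using infinite_nat_above [OF inf] .
    have "\<not> (\<exists>n. C (prod_encode (x, y)) n)"
      using Y [of y] y(2) unfolding C_def by (simp only: proj_prod_encode) auto
    then show ?thesis using N [of x y] x y by auto
  qed
  have settled: "(\<exists>n. H e n) \<longleftrightarrow> (\<exists>n. n < y \<and> H e n)"
    if "x \<in> A" "y \<in> A" "N \<le> x" "x < y" "e < x" for e x y
    using N [OF that(1-4)] \<open>\<not> b\<close> that(5) unfolding C_def proj_prod_encode by blast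
  define T where "T e z \<longleftrightarrow> proj1 z \<in> A \<and> proj2 z \<in> A \<and> N \<le> proj1 z \<and> proj1 z < proj2 z \<and> e < proj1 z" for e z
  have T_dec: "dec A (\<lambda>w. T (proj1 w) (proj2 w))"
    unfolding T_def by (intro recs dec_comp [OF dec_mem])
  have HA: "rec_fun A f \<Longrightarrow> rec_fun A g \<Longrightarrow> dec A (\<lambda>x. H (f x) (g x))" for f g
    using dec_comp [OF dec_empty [OF H] rec_fun_pair] by simp
  have ex: "\<exists>z. T e z" for e
  proof -
    obtain x where x: "x \<in> A" "max e N < x" using infinite_nat_above [OF inf] .
    obtain y where "y \<in> A" "x < y" using infinite_nat_above [OF inf] .
    with x have "T e (prod_encode (x, y))" by (simp add: T_def)
    then show ?thesis ..
  qed
  have T: "(\<exists>n. H e n) \<longleftrightarrow> (\<exists>n. n < proj2 z \<and> H e n)" if "T e z" for e z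
    using that settled unfolding T_def by blast
  show ?thesis
  proof (rule post)
    show "dec A (\<lambda>w. T (proj1 w) (proj2 w) \<and> (\<exists>n. n < proj2 (proj2 w) \<and> H (proj1 w) n))"
      by (intro recs T_dec HA)
    show "dec A (\<lambda>w. T (proj1 w) (proj2 w) \<and> \<not> (\<exists>n. n < proj2 (proj2 w) \<and> H (proj1 w) n))"
      by (intro recs T_dec HA)
    show "(\<exists>n. H e n) \<longleftrightarrow> (\<exists>z. T e z \<and> (\<exists>n. n < proj2 z \<and> H e n))" for e
      using T ex by blast
    show "\<not> (\<exists>n. H e n) \<longleftrightarrow> (\<exists>z. T e z \<and> \<not> (\<exists>n. n < proj2 z \<and> H e n))" for e
      using T [of e] ex [of e] by blast
  qed
qed

lemma splitting_family:
  fixes D :: "nat \<Rightarrow> 'a set"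
  assumes "\<And>j. j < n \<Longrightarrow> 2 * j + 2 \<le> card (D j)"
  shows "\<exists>G G'. finite G \<and> finite G' \<and> G \<inter> G' = {} \<and> card (G \<union> G') \<le> 2 * n \<and>
    (\<forall>j<n. D j \<inter> G \<noteq> {} \<and> D j \<inter> G' \<noteq> {})"
  using assms
proof (induction n)
  case 0
  show ?case by (intro exI [of _ "{}"]) simp
next
  case (Suc n)
  then obtain G G' where G: "finite G" "finite G'" "G \<inter> G' = {}" "card (G \<union> G') \<le> 2 * n"
    "\<forall>j<n. D j \<inter> G \<noteq> {} \<and> D j \<inter> G' \<noteq> {}" by (meson less_SucI)
  have "2 \<le> card (D n) - card (G \<union> G')" using Suc.prems [of n] G(4) by simp
  also have "\<dots> \<le> card (D n - (G \<union> G'))"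
    using G(1,2) by (intro diff_card_le_card_Diff) simp
  finally obtain E where "E \<subseteq> D n - (G \<union> G')" "card E = 2"
    by (meson obtain_subset_with_card_n)
  then obtain d d' where d: "d \<in> D n - (G \<union> G')" "d' \<in> D n - (G \<union> G')" "d \<noteq> d'"
    by (auto simp: card_2_iff)
  have "insert d G \<union> insert d' G' = insert d (insert d' (G \<union> G'))" by blast
  then have "card (insert d G \<union> insert d' G') \<le> 2 * Suc n"
    using G d by simp
  moreover have "insert d G \<inter> insert d' G' = {}" using G(3) d by blast
  moreover have "\<forall>j<Suc n. D j \<inter> insert d G \<noteq> {} \<and> D j \<inter> insert d' G' \<noteq> {}"
    using G(5) d by (auto simp: less_Suc_eq)
  ultimately show ?case using G(1,2) by (meson finite.insertI)
qed

lemma infinite_card_below: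
  fixes A :: "nat set"
  assumes "infinite A" shows "\<exists>b. k \<le> card {x. x < b \<and> x \<in> A}"
proof -
  obtain E where E: "finite E" "card E = k" "E \<subseteq> A"
    using infinite_arbitrarily_large [OF assms] by blast
  obtain b where "E \<subseteq> {..<b}" using finite_nat_bounded [OF E(1)] by blast
  then have "E \<subseteq> {x. x < b \<and> x \<in> A}" using E(3) by blast
  then have "card E \<le> card {x. x < b \<and> x \<in> A}" by (intro card_mono) auto
  then show ?thesis using E(2) by blast
qed

locale Sigma2_Pi2 =
  fixes Q R :: "nat \<Rightarrow> nat \<Rightarrow> nat \<Rightarrow> bool"
    and A :: "nat set"
  assumes Q: "dec {} (\<lambda>w. Q (proj1 w) (proj1 (proj2 w)) (proj2 (proj2 w)))"
    and R: "dec {} (\<lambda>w. R (proj1 w) (proj1 (proj2 w)) (proj2 (proj2 w)))"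
    and A_iff: "\<And>x. x \<in> A \<longleftrightarrow> (\<forall>a. \<exists>z. R x a z)"
    and A: "two_cohesive A"
begin

lemma inf: "infinite A"
  using A unfolding two_cohesive_def ..

lemma Q_dec: "rec_fun B f \<Longrightarrow> rec_fun B g \<Longrightarrow> rec_fun B h \<Longrightarrow> dec B (\<lambda>x. Q (f x) (g x) (h x))"
  using dec_comp [OF dec_empty [OF Q] rec_fun_pair [OF _ rec_fun_pair]] by simp

lemma R_dec: "rec_fun B f \<Longrightarrow> rec_fun B g \<Longrightarrow> rec_fun B h \<Longrightarrow> dec B (\<lambda>x. R (f x) (g x) (h x))"
  using dec_comp [OF dec_empty [OF R] rec_fun_pair [OF _ rec_fun_pair]] by simp

definition level :: "nat \<Rightarrow> nat \<Rightarrow> bool" where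
  "level x u \<longleftrightarrow> (\<forall>a. a \<le> u \<longrightarrow> (\<exists>z. R x a z))"

definition level_at :: "nat \<Rightarrow> nat \<Rightarrow> nat \<Rightarrow> bool" where
  "level_at y x u \<longleftrightarrow> (\<forall>a. a \<le> u \<longrightarrow> (\<exists>z. z < y \<and> R x a z))"

text \<open>
  \<open>active y e u\<close>: at stage \<open>y\<close>, \<open>u\<close> looks like the least witness for \<open>e\<close>; \<open>u\<close> is then unique.
\<close>

definition active :: "nat \<Rightarrow> nat \<Rightarrow> nat \<Rightarrow> bool" where
  "active y e u \<longleftrightarrow> (\<forall>u'. u' < u \<longrightarrow> (\<exists>v. v < y \<and> Q e u' v)) \<and> \<not> (\<exists>v. v < y \<and> Q e u v)"

definition cand :: "nat \<Rightarrow> nat \<Rightarrow> nat \<Rightarrow> bool" where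
  "cand y j x \<longleftrightarrow> j \<le> x \<and> (\<exists>u. u < y \<and> active y (proj1 j) u \<and> level_at y x u)"

text \<open>
  Demanding the splitting for every \<open>b\<close> with enough candidates below it is no stronger than demanding
  it for the least one, and avoids extracting the first \<open>2 j + 2\<close> candidates.
\<close>

definition splits :: "nat \<Rightarrow> nat \<Rightarrow> bool" where
  "splits y g \<longleftrightarrow> (\<forall>j. j < y \<longrightarrow> (\<forall>b. b \<le> y \<longrightarrow>
     2 * j + 2 \<le> card {x. x < b \<and> cand y j x} \<longrightarrow>
     (\<exists>x. x < b \<and> cand y j x \<and> x \<in> set_decode g) \<and>
     (\<exists>x. x < b \<and> cand y j x \<and> \<not> x \<in> set_decode g)))"

lemma ex_splits: "\<exists>g. splits y g"
proof -
  define S where "S j b = {x. x < b \<and> cand y j x}" for j b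
  define D where "D j = (if \<exists>b. 2 * j + 2 \<le> card (S j b)
    then S j (LEAST b. 2 * j + 2 \<le> card (S j b)) else {..<2 * j + 2})" for j
  have "2 * j + 2 \<le> card (D j)" for j
  proof (cases "\<exists>b. 2 * j + 2 \<le> card (S j b)")
    case True
    from LeastI_ex [OF True] True show ?thesis by (simp add: D_def)
  next
    case False
    then show ?thesis by (simp add: D_def)
  qed
  from splitting_family [of y D, OF this] obtain G G' where
    G: "finite G" "G \<inter> G' = {}" "\<forall>j<y. D j \<inter> G \<noteq> {} \<and> D j \<inter> G' \<noteq> {}" by blast
  have "D j \<subseteq> S j b" if "2 * j + 2 \<le> card (S j b)" for j b
  proof -
    have "S j b' \<subseteq> S j b" if "b' \<le> b" for b' using that by (auto simp: S_def)
    moreover have "(LEAST b. 2 * j + 2 \<le> card (S j b)) \<le> b" using that by (rule Least_le)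
    moreover have "\<exists>b. 2 * j + 2 \<le> card (S j b)" using that ..
    then have "D j = S j (LEAST b. 2 * j + 2 \<le> card (S j b))" by (simp only: D_def if_P)
    ultimately show ?thesis by (simp only:)
  qed
  then have "splits y (set_encode G)"
    using G unfolding splits_def S_def by (simp add: set_encode_inverse) blast
  then show ?thesis ..
qed

definition splitter :: "nat \<Rightarrow> nat \<Rightarrow> bool" where
  "splitter y g \<longleftrightarrow> splits y g \<and> \<not> (\<exists>g'. g' < g \<and> splits y g')"

lemma ex_splitter: "\<exists>g. splitter y g"
  using ex_splits exists_least_iff [of "splits y"] unfolding splitter_def by blast

lemma splitter_unique: "splitter y g \<Longrightarrow> splitter y g' \<Longrightarrow> g = g'"
  unfolding splitter_def by (meson linorder_neqE_nat)

lemma splits_dec: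
  assumes "rec_fun B f" "rec_fun B g" shows "dec B (\<lambda>x. splits (f x) (g x))"
  unfolding splits_def cand_def active_def level_at_def
  by (intro recs Q_dec R_dec assms assms [THEN rec_fun_comp])

lemma eventually_level_at:
  "\<forall>\<^sub>F y in sequentially. level x u \<longrightarrow> level_at y x u"
proof -
  have "\<forall>\<^sub>F y in sequentially. \<forall>a\<in>{..u}. (\<exists>z. R x a z) \<longrightarrow> (\<exists>z. z < y \<and> R x a z)"
    by (intro eventually_ball_finite ballI eventually_ex_less) simp
  then show ?thesis by (rule eventually_mono) (auto simp: level_def level_at_def)
qed

lemma level_at_imp_level: "level_at y x u \<Longrightarrow> level x u"
  unfolding level_def level_at_def by blast

lemma escape:
  obtains N where "\<And>j b u. N \<le> j \<Longrightarrow> (\<forall>v. \<not> Q (proj1 j) u v) \<Longrightarrow>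
    (\<forall>u'<u. \<exists>v. Q (proj1 j) u' v) \<Longrightarrow> 2 * j + 2 \<le> card {x. x < b \<and> j \<le> x \<and> level x u} \<Longrightarrow>
    \<exists>x. x < b \<and> j \<le> x \<and> level x u \<and> x \<notin> A"
proof -
  define C where "C w g \<longleftrightarrow> splitter (proj2 w) g \<and> proj1 w \<in> set_decode g" for w g
  have "dec {} (\<lambda>w. C (proj1 w) (proj2 w))"
    unfolding C_def splitter_def by (intro recs splits_dec)
  from two_cohesive_coloring [OF A this] obtain N i where
    "\<forall>x\<in>A. \<forall>y\<in>A. N \<le> x \<longrightarrow> x < y \<longrightarrow> ((\<exists>n. C (prod_encode (x, y)) n) \<longleftrightarrow> i)"
    by (elim exE)
  note N = this [rule_format]
  have "\<exists>x. x < b \<and> j \<le> x \<and> level x u \<and> x \<notin> A"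
    if j: "N \<le> j" and u: "\<forall>v. \<not> Q (proj1 j) u v" "\<forall>u'<u. \<exists>v. Q (proj1 j) u' v"
      and card: "2 * j + 2 \<le> card {x. x < b \<and> j \<le> x \<and> level x u}" for j b u
  proof (rule ccontr)
    assume "\<not> ?thesis"
    then have sub: "x \<in> A" if "x < b" "j \<le> x" "level x u" for x using that by blast
    have "\<forall>\<^sub>F y in sequentially. (\<forall>x\<in>{..<b}. level x u \<longrightarrow> level_at y x u) \<and>
        (\<forall>u'\<in>{..<u}. (\<exists>v. Q (proj1 j) u' v) \<longrightarrow> (\<exists>v. v < y \<and> Q (proj1 j) u' v)) \<and>
        b < y \<and> j < y \<and> u < y"
      by (intro eventually_conj eventually_ball_finite ballI eventually_level_at
          eventually_ex_less eventually_gt_at_top) simp_all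
    then obtain Y where Y: "\<And>y. Y \<le> y \<Longrightarrow> (\<forall>x\<in>{..<b}. level x u \<longrightarrow> level_at y x u) \<and>
        (\<forall>u'\<in>{..<u}. (\<exists>v. Q (proj1 j) u' v) \<longrightarrow> (\<exists>v. v < y \<and> Q (proj1 j) u' v)) \<and>
        b < y \<and> j < y \<and> u < y"
      unfolding eventually_sequentially by blast
    obtain y where y: "y \<in> A" "Y < y" using infinite_nat_above [OF inf] .
    note Y = Y [OF less_imp_le [OF y(2)]]
    have act: "active y (proj1 j) u' \<longleftrightarrow> u' = u" for u'
      using Y u unfolding active_def by (metis lessThan_iff linorder_neqE_nat)
    have cand: "cand y j x \<longleftrightarrow> j \<le> x \<and> level x u" if "x < b" for x
      unfolding cand_def act using Y that level_at_imp_level by blast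
    obtain g where g: "splitter y g" using ex_splitter by blast
    have "{x. x < b \<and> cand y j x} = {x. x < b \<and> j \<le> x \<and> level x u}" using cand by blast
    then have "2 * j + 2 \<le> card {x. x < b \<and> cand y j x}" using card by simp
    then obtain x x' where x: "x < b" "cand y j x" "x \<in> set_decode g"
      and x': "x' < b" "cand y j x'" "x' \<notin> set_decode g"
      using g Y unfolding splitter_def splits_def by (meson less_imp_le)
    have "x \<in> A" "x' \<in> A" "N \<le> x" "N \<le> x'" "x < y" "x' < y"
      using x(1,2) x'(1,2) cand sub j Y by auto
    then show False
      using N [of x y] N [of x' y] y(1) g x(3) x'(3) splitter_unique [OF g]
      unfolding C_def proj_prod_encode by blast
  qed
  then show ?thesis by (rule that)
qed

lemma dec_Sigma2: "dec A (\<lambda>e. \<exists>u. \<forall>v. \<not> Q e u v)"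
proof -
  obtain N where N: "\<And>j b u. N \<le> j \<Longrightarrow> (\<forall>v. \<not> Q (proj1 j) u v) \<Longrightarrow>
    (\<forall>u'<u. \<exists>v. Q (proj1 j) u' v) \<Longrightarrow> 2 * j + 2 \<le> card {x. x < b \<and> j \<le> x \<and> level x u} \<Longrightarrow>
    \<exists>x. x < b \<and> j \<le> x \<and> level x u \<and> x \<notin> A"
    by (fact escape)
  define j where "j e = prod_encode (e, N)" for e
  have j: "proj1 (j e) = e" "N \<le> j e" for e
    by (simp_all add: j_def le_prod_encode_2)
  define below where "below e u \<longleftrightarrow> (\<forall>u'. u' \<le> u \<longrightarrow> (\<exists>v. Q e u' v))" for e u
  define T where "T e b u \<longleftrightarrow> 2 * j e + 2 \<le> card {x. x < b \<and> (j e \<le> x \<and> x \<in> A)} \<and>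
    (\<forall>x. x < b \<longrightarrow> j e \<le> x \<longrightarrow> \<not> x \<in> A \<longrightarrow> \<not> level x u) \<and> below e u" for e b u
  have "dec A (\<lambda>w. \<exists>v. Q (proj1 w) (proj2 w) v)"
    by (intro dec_two_cohesive_ex [OF A] Q_dec recs)
  then have Q_ex: "rec_fun A f \<Longrightarrow> rec_fun A g \<Longrightarrow> dec A (\<lambda>x. \<exists>v. Q (f x) (g x) v)" for f g
    using dec_comp [OF _ rec_fun_pair, of A "\<lambda>w. \<exists>v. Q (proj1 w) (proj2 w) v"] by simp
  have "dec A (\<lambda>w. \<exists>z. R (proj1 w) (proj2 w) z)"
    by (intro dec_two_cohesive_ex [OF A] R_dec recs)
  then have R_ex: "rec_fun A f \<Longrightarrow> rec_fun A g \<Longrightarrow> dec A (\<lambda>x. \<exists>z. R (f x) (g x) z)" for f g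
    using dec_comp [OF _ rec_fun_pair, of A "\<lambda>w. \<exists>z. R (proj1 w) (proj2 w) z"] by simp
  show ?thesis
  proof (rule post)
    show "dec A (\<lambda>w. \<not> below (proj1 w) (proj2 w))"
      unfolding below_def by (intro recs Q_ex)
    show "dec A (\<lambda>w. T (proj1 w) (proj1 (proj2 w)) (proj2 (proj2 w)))"
      unfolding T_def below_def level_def j_def
      by (intro recs Q_ex R_ex dec_comp [OF dec_mem])
    show "(\<exists>u. \<forall>v. \<not> Q e u v) \<longleftrightarrow> (\<exists>u. \<not> below e u)" for e
      unfolding below_def by blast
    show "\<not> (\<exists>u. \<forall>v. \<not> Q e u v) \<longleftrightarrow> (\<exists>w. T e (proj1 w) (proj2 w))" for e
    proof
      assume "\<not> (\<exists>u. \<forall>v. \<not> Q e u v)"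
      then have below: "below e u" for u unfolding below_def by blast
      have "infinite (A - {..<j e})" using inf by simp
      from infinite_card_below [OF this, of "2 * j e + 2"] obtain b
        where b: "2 * j e + 2 \<le> card {x. x < b \<and> x \<in> A - {..<j e}}" by blast
      moreover have "{x. x < b \<and> x \<in> A - {..<j e}} = {x. x < b \<and> (j e \<le> x \<and> x \<in> A)}" by auto
      ultimately have b: "2 * j e + 2 \<le> card {x. x < b \<and> (j e \<le> x \<and> x \<in> A)}" by simp
      have "\<forall>\<^sub>F u in sequentially. \<forall>x\<in>{..<b}. x \<notin> A \<longrightarrow> \<not> level x u"
      proof (intro eventually_ball_finite ballI)
        fix x
        show "\<forall>\<^sub>F u in sequentially. x \<notin> A \<longrightarrow> \<not> level x u"
        proof (cases "x \<in> A")
          case False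
          then obtain a where "\<nexists>z. R x a z" using A_iff by blast
          then show ?thesis
            by (intro eventually_mono [OF eventually_ge_at_top [of a]]) (auto simp: level_def)
        qed simp
      qed simp
      then obtain u where "\<forall>x\<in>{..<b}. x \<notin> A \<longrightarrow> \<not> level x u"
        unfolding eventually_sequentially by blast
      then have "T e b u" unfolding T_def using b below by simp
      then show "\<exists>w. T e (proj1 w) (proj2 w)" by (metis proj_prod_encode)
    next
      assume "\<exists>w. T e (proj1 w) (proj2 w)"
      then obtain b u where T: "T e b u" by blast
      show "\<not> (\<exists>u. \<forall>v. \<not> Q e u v)"
      proof
        assume "\<exists>u. \<forall>v. \<not> Q e u v"
        then obtain u0 where u0: "\<forall>v. \<not> Q e u0 v" "\<forall>u'<u0. \<exists>v. Q e u' v"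
          using exists_least_iff [of "\<lambda>u. \<forall>v. \<not> Q e u v"] by blast
        have "u < u0" using T u0(1) unfolding T_def below_def by (meson not_le)
        have "{x. x < b \<and> (j e \<le> x \<and> x \<in> A)} \<subseteq> {x. x < b \<and> j e \<le> x \<and> level x u0}"
          unfolding A_iff level_def by blast
        then have "card {x. x < b \<and> (j e \<le> x \<and> x \<in> A)} \<le> card {x. x < b \<and> j e \<le> x \<and> level x u0}"
          by (intro card_mono) auto
        then have "2 * j e + 2 \<le> card {x. x < b \<and> j e \<le> x \<and> level x u0}"
          using T unfolding T_def by linarith
        then obtain x where x: "x < b" "j e \<le> x" "level x u0" "x \<notin> A"
          using N [of "j e" u0 b] j u0 by auto
        have "level x u" using x(3) \<open>u < u0\<close> unfolding level_def by simp
        then show False using T x unfolding T_def by blast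
      qed
    qed
  qed
qed

end

theorem theorem3p9:
  fixes A :: "nat set"
  assumes "two_cohesive A" and "Pi2_set A"
  shows "turing_degree A = turing_degree (jump (jump {}))"
proof (rule turing_degree_eqI)
  obtain R where R': "computable_set R"
    and A_eq: "A = {x. \<forall>y. \<exists>z. prod_encode (x, prod_encode (y, z)) \<in> R}"
    using assms(2) unfolding Pi2_set_def by blast
  have dec_R: "dec {} (\<lambda>w. w \<in> R)"
    using R' by (simp only: computable_set_def turing_reducible_iff_dec)
  obtain Q where Q': "dec {} (\<lambda>w. Q (proj1 w) (proj1 (proj2 w)) (proj2 (proj2 w)))"
    "\<And>e. e \<in> jump (jump {}) \<longleftrightarrow> (\<exists>u. \<forall>v. \<not> Q e u v)"
    by (fact double_jump_Sigma2)
  interpret Sigma2_Pi2 Q "\<lambda>x a z. prod_encode (x, prod_encode (a, z)) \<in> R" A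
  proof
    show "dec {} (\<lambda>w. prod_encode (proj1 w, prod_encode (proj1 (proj2 w), proj2 (proj2 w))) \<in> R)"
      using dec_R by simp
    show "x \<in> A \<longleftrightarrow> (\<forall>a. \<exists>z. prod_encode (x, prod_encode (a, z)) \<in> R)" for x
      using A_eq by blast
  qed (rule Q'(1), rule assms(1))
  show "turing_reducible (jump (jump {})) A"
    unfolding turing_reducible_iff_dec Q'(2) by (rule dec_Sigma2)
  have J: "dec (jump {}) (\<lambda>w. \<exists>z. prod_encode (proj1 w, prod_encode (proj2 w, z)) \<in> R)"
    by (rule dec_jump_ex, rule dec_comp [OF dec_R]) (intro recs)
  have "dec (jump (jump {})) (\<lambda>x. \<exists>y. \<not> (\<exists>z. prod_encode (x, prod_encode (y, z)) \<in> R))"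
    by (rule dec_jump_ex, rule dec_not, rule J)
  then have "dec (jump (jump {})) (\<lambda>x. \<not> (\<exists>y. \<not> (\<exists>z. prod_encode (x, prod_encode (y, z)) \<in> R)))"
    by (rule dec_not)
  then show "turing_reducible A (jump (jump {}))"
    unfolding turing_reducible_iff_dec by (simp add: A_eq)
qed

end
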